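(* Let $G$ be a $C_{4k}$-free bipartite graph. Then (1) $\operatorname{null}(G)=\operatorname{null}(C_S(G))=\sum_{H\in\mathcal{K}(C_S(G))}\operatorname{null}(H)$; (2) $\operatorname{Null}(G)=\operatorname{Null}(C_S(G))\!\uparrow^{G}$; (3) $\operatorname{Null}(C_S(G))=\bigoplus_{H\in\mathcal{K}(C_S(G))}\operatorname{Null}(H)\!\uparrow^{C_S(G)}$; (4) $\operatorname{Null}(G)=\bigoplus_{H\in\mathcal{K}(C_S(G))}\operatorname{Null}(H)\!\uparrow^{G}$.
   Context: All graphs are finite, simple and undirected. A graph is a $C_{4k}$-free bipartite graph if it is bipartite and contains no cycle whose length is a multiple of $4$. For a graph $G$, $\operatorname{Null}(G)=\{\vec{x}\in\mathbb{R}^{V(G)}:A(G)\vec{x}=0\}$ where $A(G)$ is the adjacency matrix, and $\operatorname{null}(G)=\dim\operatorname{Null}(G)$. $\operatorname{Supp}(G)$ is the set of vertices $v$ with $\vec{x}_v\neq0$ for some $\vec{x}\in\operatorname{Null}(G)$; $\operatorname{Core}(G)$ is the set of vertices adjacent to some vertex of $\operatorname{Supp}(G)$. $C_S(G)$ is the subgraph of $G$ induced by $\operatorname{Supp}(G)\cup\operatorname{Core}(G)$. $\mathcal{K}(F)$ denotes the set of connected components of a graph $F$. For a subgraph $H$ of a graph $F$ and $\vec{y}\in\mathbb{R}^{V(H)}$, the lift $\vec{y}\!\uparrow^{F}\in\mathbb{R}^{V(F)}$ is defined by $(\vec{y}\!\uparrow^{F})_u=\vec{y}_u$ for $u\in V(H)$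 and $(\vec{y}\!\uparrow^{F})_u=0$ for $u\in V(F)\setminus V(H)$; for a set $Y$ of vectors, $Y\!\uparrow^{F}=\{\vec{y}\!\uparrow^{F}:\vec{y}\in Y\}$. *)

theory Defs
  imports Complex_Main "Graph_Theory.Graph_Theory" "HOL-Library.Function_Algebras"
begin

text \<open>
  Finite simple undirected graphs are the locale \<^locale>\<open>graph\<close>: finite symmetric digraphs without
  loops and parallel arcs, where an edge between u and v is the pair of arcs u to v and v to u.
\<close>

subsection \<open>The real vector space of real functions\<close>

instantiation "fun" :: (type, real_vector) real_vector
begin

definition scaleR_fun_def: "scaleR c f = (\<lambda>x. c *\<^sub>R f x)"

instance
  by standard (simp_all add: scaleR_fun_def fun_eq_iff scaleR_add_right scaleR_add_left)

end

text \<open>Internal direct sum of a finite family of subspaces.\<close>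

definition is_direct_sum :: "'v::real_vector set \<Rightarrow> 'i set \<Rightarrow> ('i \<Rightarrow> 'v set) \<Rightarrow> bool" where
  "is_direct_sum U I W \<longleftrightarrow>
     finite I \<and> (\<forall>i\<in>I. subspace (W i)) \<and>
     U = {\<Sum>i\<in>I. w i |w. \<forall>i\<in>I. w i \<in> W i} \<and>
     (\<forall>w. (\<forall>i\<in>I. w i \<in> W i) \<and> (\<Sum>i\<in>I. w i) = 0 \<longrightarrow> (\<forall>i\<in>I. w i = 0))"

subsection \<open>Graphs\<close>

definition bipartite :: "('a, 'b) pre_digraph \<Rightarrow> bool" where
  "bipartite G \<longleftrightarrow>
     (\<exists>A B. verts G = A \<union> B \<and> A \<inter> B = {} \<and>
       (\<forall>e\<in>arcs G. (tail G e \<in> A \<and> head G e \<in> B) \<or> (tail G e \<in> B \<and> head G e \<in> A)))"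

text \<open>
  The library's notion of cycle is nonempty, and in a symmetric digraph it also admits the closed
  walks u, v, u of length 2; these are harmless here because 4 does not divide 2.
\<close>

definition C4k_free_bipartite :: "('a, 'b) pre_digraph \<Rightarrow> bool" where
  "C4k_free_bipartite G \<longleftrightarrow>
     graph G \<and> bipartite G \<and> \<not> (\<exists>p. pre_digraph.cycle G p \<and> 4 dvd length p)"

definition components :: "('a, 'b) pre_digraph \<Rightarrow> ('a, 'b) pre_digraph set" where
  "components F = {H. pre_digraph.max_subgraph F Digraph_Component.connected H}"

subsection \<open>Null space, support and core\<close>

text \<open>
  A vector indexed by the vertices of G is a function on the whole vertex type that is 0 outside
  the vertex set. The zeros outside are padding only: all conditions below range over the vertices
  of the graph in question.
\<close>

definition vertex_vectors :: "('a, 'b) pre_digraph \<Rightarrow> ('a \<Rightarrow> real) set" where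
  "vertex_vectors G = {x. \<forall>v. v \<notin> verts G \<longrightarrow> x v = 0}"

definition adjacency :: "('a, 'b) pre_digraph \<Rightarrow> 'a \<Rightarrow> 'a \<Rightarrow> real" where
  "adjacency G u v = (if u \<rightarrow>\<^bsub>G\<^esub> v then 1 else 0)"

definition null_space :: "('a, 'b) pre_digraph \<Rightarrow> ('a \<Rightarrow> real) set" where
  "null_space G =
     {x \<in> vertex_vectors G. \<forall>u\<in>verts G. (\<Sum>v\<in>verts G. adjacency G u v * x v) = 0}"

definition nullity :: "('a, 'b) pre_digraph \<Rightarrow> nat" where
  "nullity G = dim (null_space G)"

definition Supp :: "('a, 'b) pre_digraph \<Rightarrow> 'a set" where
  "Supp G = {v \<in> verts G. \<exists>x\<in>null_space G. x v \<noteq> 0}"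

definition Core :: "('a, 'b) pre_digraph \<Rightarrow> 'a set" where
  "Core G = {v \<in> verts G. \<exists>u\<in>Supp G. u \<rightarrow>\<^bsub>G\<^esub> v}"

definition C_S :: "('a, 'b) pre_digraph \<Rightarrow> ('a, 'b) pre_digraph" where
  "C_S G = G \<restriction> (Supp G \<union> Core G)"

text \<open>
  Lift of a vector from a subgraph H of F to F. The outer conditional is the padding convention
  for vectors indexed by the vertices of F.
\<close>

definition lift_vec ::
    "('a, 'b) pre_digraph \<Rightarrow> ('a, 'b) pre_digraph \<Rightarrow> ('a \<Rightarrow> real) \<Rightarrow> 'a \<Rightarrow> real" where
  "lift_vec H F y =
     (\<lambda>u. if u \<in> verts F then (if u \<in> verts H then y u else 0) else 0)"

end

theory Submission
  imports Defs
begin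

text \<open>
  If \<open>x\<close> is a null vector of \<open>G\<close> and \<open>y\<close> one of \<open>C_S G\<close>, then \<open>y u * x v = 0\<close> for every edge \<open>u v\<close>:
  with \<open>u\<close> ranging over one colour class and \<open>v\<close> over the other, these products sum to zero over the
  edges at any vertex. Orient the edges of positive weight from the first class to the second and
  those of negative weight backwards; then every vertex that can be entered can be left, so a nonzero
  weight yields a directed cycle. Two steps along it flip the sign of the vector living on the
  current class, so its length is a multiple of 4, a contradiction. Hence null vectors of \<open>C_S G\<close>
  vanish on the core, which makes them null vectors of \<open>G\<close>.
\<close>

subsection \<open>Direct sums\<close>

lemma sum_fun_apply: "(\<Sum>i\<in>I. f i) x = (\<Sum>i\<in>I. f i x)"
  by (induction I rule: infinite_finite_induct) auto

lemma is_direct_sum_cong: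
  assumes "\<And>i. i \<in> I \<Longrightarrow> W i = W' i"
  shows "is_direct_sum U I W \<longleftrightarrow> is_direct_sum U I W'"
  using assms by (simp add: is_direct_sum_def)

text \<open>A nonzero common vector would cancel against its own negative taken from the other
  summand. This keeps bases of different summands disjoint.\<close>

lemma is_direct_sum_Int:
  assumes ds: "is_direct_sum U I W" and ij: "i \<in> I" "j \<in> I" "i \<noteq> j" and v: "v \<in> W i" "v \<in> W j"
  shows "v = 0"
proof -
  define w where "w k = (if k = i then v else 0) + (if k = j then - v else 0)" for k
  have fin: "finite I" and sub: "\<And>k. k \<in> I \<Longrightarrow> subspace (W k)"
    using ds by (auto simp: is_direct_sum_def)
  have "\<forall>k\<in>I. w k \<in> W k"
    using sub v ij by (auto simp: w_def subspace_0 subspace_neg)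
  moreover have "(\<Sum>k\<in>I. w k) = 0"
    using fin ij by (simp add: w_def sum.distrib sum.delta')
  ultimately have "w i = 0"
    using ds ij unfolding is_direct_sum_def by blast
  then show ?thesis
    using ij by (simp add: w_def)
qed

text \<open>Bases of the summands together form a basis of \<open>U\<close>. Function spaces can be
  infinite-dimensional; the finite set \<open>T\<close> is what makes these bases finite.\<close>

lemma dim_is_direct_sum:
  assumes ds: "is_direct_sum U I W" and T: "finite T" "U \<subseteq> span T"
  shows "dim U = (\<Sum>i\<in>I. dim (W i))"
proof -
  have fin: "finite I" and sub: "\<And>i. i \<in> I \<Longrightarrow> subspace (W i)"
    and U: "U = {\<Sum>i\<in>I. w i |w. \<forall>i\<in>I. w i \<in> W i}"
    and indep: "\<And>w. (\<And>i. i \<in> I \<Longrightarrow> w i \<in> W i) \<Longrightarrow> (\<Sum>i\<in>I. w i) = 0 \<Longrightarrow> \<forall>i\<in>I. w i = 0"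
    using ds unfolding is_direct_sum_def by blast+
  have W_U: "W i \<subseteq> U" if "i \<in> I" for i
  proof
    fix v assume "v \<in> W i"
    then have "\<forall>k\<in>I. (if k = i then v else 0) \<in> W k"
      by (simp add: sub subspace_0)
    moreover have "v = (\<Sum>k\<in>I. if k = i then v else 0)"
      using that fin by simp
    ultimately show "v \<in> U"
      unfolding U by blast
  qed
  have "\<exists>B. B \<subseteq> W i \<and> independent B \<and> W i \<subseteq> span B \<and> card B = dim (W i)" for i
    using basis_exists by metis
  then obtain B where B: "\<And>i. B i \<subseteq> W i" "\<And>i. independent (B i)" "\<And>i. W i \<subseteq> span (B i)"
    "\<And>i. card (B i) = dim (W i)"
    by metis
  have finB: "finite (B i)" if "i \<in> I" for i
    using independent_span_bound[OF T(1) B(2)] B(1) W_U[OF that] T(2) by blast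
  have disj: "B i \<inter> B j = {}" if "i \<in> I" "j \<in> I" "i \<noteq> j" for i j
  proof (rule ccontr)
    assume "B i \<inter> B j \<noteq> {}"
    then obtain v where v: "v \<in> B i" "v \<in> B j"
      by blast
    then have "v = 0"
      using is_direct_sum_Int[OF ds that] B(1) by blast
    then show False
      using v(1) B(2) dependent_zero by blast
  qed
  define C where "C = (\<Union>i\<in>I. B i)"
  have sumC: "sum f C = (\<Sum>i\<in>I. sum f (B i))" for f :: "'a \<Rightarrow> 'a"
    unfolding C_def using fin finB disj by (intro sum.UNION_disjoint) auto
  have indC: "independent C"
  proof (rule independent_if_scalars_zero)
    show "finite C"
      unfolding C_def using fin finB by blast
    fix c v
    assume 0: "(\<Sum>v\<in>C. c v *\<^sub>R v) = 0" and "v \<in> C"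
    then obtain i where i: "i \<in> I" "v \<in> B i"
      unfolding C_def by blast
    \<comment> \<open>Grouping the vanishing combination by summand gives one vector in each
      \<open>W k\<close>. Directness makes each of them zero, and independence of \<open>B i\<close>
      finishes.\<close>
    have "(\<Sum>v\<in>B k. c v *\<^sub>R v) \<in> W k" if "k \<in> I" for k
      using sub[OF that] B(1)[of k] by (auto intro!: subspace_sum subspace_scale)
    then have "(\<Sum>v\<in>B i. c v *\<^sub>R v) = 0"
      using indep[of "\<lambda>k. \<Sum>v\<in>B k. c v *\<^sub>R v"] 0 i(1) by (simp add: sumC)
    then show "c v = 0"
      using independentD[OF B(2) finB[OF i(1)] subset_refl] i(2) by blast
  qed
  have "C \<subseteq> U"
    unfolding C_def using B(1) W_U by blast
  moreover have "U \<subseteq> span C"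
  proof
    fix u assume "u \<in> U"
    then obtain w where w: "u = (\<Sum>i\<in>I. w i)" "\<forall>i\<in>I. w i \<in> W i"
      unfolding U by blast
    have "span (B i) \<subseteq> span C" if "i \<in> I" for i
      using that unfolding C_def by (intro span_mono) blast
    then show "u \<in> span C"
      unfolding w(1) using w(2) B(3) by (blast intro: span_sum)
  qed
  ultimately have "dim U = card C"
    using basis_card_eq_dim indC by metis
  also have "\<dots> = (\<Sum>i\<in>I. card (B i))"
    unfolding C_def using fin finB disj by (intro card_UN_disjoint) auto
  finally show ?thesis
    by (simp add: B(4))
qed

subsection \<open>Null spaces\<close>

lemma null_space_iff:
  "x \<in> null_space G \<longleftrightarrow> (\<forall>v. v \<notin> verts G \<longrightarrow> x v = 0) \<and>
    (\<forall>u\<in>verts G. (\<Sum>v\<in>verts G. adjacency G u v * x v) = 0)"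
  by (simp add: null_space_def vertex_vectors_def)

lemma subspace_null_space: "subspace (null_space G)"
  unfolding subspace_def
  by (auto simp: null_space_iff scaleR_fun_def distrib_left sum.distrib mult.left_commute
      simp flip: sum_distrib_left)

text \<open>The unit vectors \<open>e v\<close> span all vectors padded by zero outside
  \<open>verts G\<close>. The result feeds \<open>dim_is_direct_sum\<close>.\<close>

lemma null_space_finite_dimensional:
  assumes "finite (verts G)"
  obtains T where "finite T" "null_space G \<subseteq> span T"
proof
  define e :: "'a \<Rightarrow> 'a \<Rightarrow> real" where "e v = (\<lambda>u. if u = v then 1 else 0)" for v
  show "finite (e ` verts G)"
    using assms by blast
  show "null_space G \<subseteq> span (e ` verts G)"
  proof
    fix x assume "x \<in> null_space G"
    then have "x = (\<Sum>v\<in>verts G. x v *\<^sub>R e v)"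
      using assms by (auto simp: fun_eq_iff sum_fun_apply scaleR_fun_def e_def null_space_iff if_distrib
          cong: if_cong)
    also have "\<dots> \<in> span (e ` verts G)"
      by (intro span_sum span_scale span_base) auto
    finally show "x \<in> span (e ` verts G)" .
  qed
qed

lemma adjacency_induce:
  assumes "u \<in> S" "v \<in> S"
  shows "adjacency (G \<restriction> S) u v = adjacency G u v"
  using assms by (auto simp: adjacency_def arcs_ends_conv)

text \<open>A vector supported on \<open>S\<close> does not see the removed vertices, so induced
  subgraphs can all be tested against the rows of the adjacency matrix of \<open>G\<close>.\<close>

lemma null_space_induce_iff:
  assumes "finite (verts G)" "S \<subseteq> verts G"
  shows "x \<in> null_space (G \<restriction> S) \<longleftrightarrow> (\<forall>v. v \<notin> S \<longrightarrow> x v = 0) \<and>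
    (\<forall>u\<in>S. (\<Sum>v\<in>verts G. adjacency G u v * x v) = 0)"
proof -
  have "(\<Sum>v\<in>S. adjacency (G \<restriction> S) u v * x v) = (\<Sum>v\<in>verts G. adjacency G u v * x v)"
    if "u \<in> S" "\<forall>v. v \<notin> S \<longrightarrow> x v = 0" for u
    using assms that by (intro sum.mono_neutral_cong_left) (auto simp: adjacency_induce)
  then show ?thesis
    by (auto simp: null_space_iff)
qed

text \<open>Null vectors are already padded by zero on the whole vertex type, so lifting them
  changes nothing.\<close>

lemma lift_vec_null_space:
  assumes "verts H \<subseteq> verts F"
  shows "lift_vec H F ` null_space H = null_space H"
proof -
  have "lift_vec H F y = y" if "y \<in> null_space H" for y
    using that assms by (auto simp: lift_vec_def null_space_iff fun_eq_iff)
  then show ?thesis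
    by force
qed

subsection \<open>Connected components\<close>

lemma (in wf_digraph) strongly_connected_imp_connected:
  assumes "strongly_connected G"
  shows "connected G"
  using assms by (intro connectedI reachable_mk_symmetricI) (auto simp: strongly_connected_def)

text \<open>Extra arcs on the same vertices cannot disconnect. Hence maximal connected subgraphs are
  induced, and so inherit symmetry.\<close>

lemma arc_mono_connected: "arc_mono connected"
  unfolding arc_mono_def
  by (metis spanning_def subgraphE wf_digraph.connected_spanning_imp_connected)

lemma (in sym_digraph) induced_connected_imp_strongly_connected:
  assumes "induced_subgraph H G" "connected H"
  shows "strongly_connected H"
  using assms
  by (metis induced_graph_imp_symmetric sym_arcs wf_digraphI_induced
      wf_digraph.symmetric_connected_imp_strongly_connected)

text \<open>Connected and strongly connected coincide on induced subgraphs, because these are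
  symmetric. The identification opens up the known facts on strong components.\<close>

lemma (in sym_digraph) components_eq_sccs: "components G = sccs"
proof -
  have "max_subgraph strongly_connected H" if H: "max_subgraph connected H" for H
  proof (rule max_subgraphI)
    show "strongly_connected H"
      using induced_subgraphI_arc_mono[OF H arc_mono_connected] max_subgraph_prop[OF H]
      by (rule induced_connected_imp_strongly_connected)
    show "subgraph H G"
      using H by (rule subgraphI_max_subgraph)
    show "\<not> strongly_connected H'" if "H \<noteq> H'" "subgraph H H'" "subgraph H' G" for H'
      using H that wf_digraph.strongly_connected_imp_connected unfolding max_subgraph_def
      by (metis subgraphE)
  qed
  moreover have "max_subgraph connected H" if H: "max_subgraph strongly_connected H" for H
  proof (rule max_subgraphI)
    show "connected H"
      using H wf_digraph.strongly_connected_imp_connected unfolding max_subgraph_def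
      by (metis subgraphE)
    show "subgraph H G"
      using H by (rule subgraphI_max_subgraph)
    fix H' assume H': "H \<noteq> H'" "subgraph H H'" "subgraph H' G"
    \<comment> \<open>\<open>H'\<close> itself may contain an arc without its reverse; the induced
      subgraph on its vertices is symmetric and still contains \<open>H'\<close>.\<close>
    let ?K = "G \<restriction> verts H'"
    show "\<not> connected H'"
    proof
      assume "connected H'"
      have sK: "subgraph H' ?K"
        using H'(3) by (rule subgraph_induce_subgraphI2)
      have iK: "induced_subgraph ?K G"
        using H'(3) by (intro induced_induce) auto
      have "connected ?K"
        using \<open>connected H'\<close> sK arc_mono_connected unfolding arc_mono_def
        by (metis induce_subgraph_verts)
      then have "strongly_connected ?K"
        using iK by (rule induced_connected_imp_strongly_connected[rotated])
      then have "?K = H"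
        using H iK subgraph_trans[OF H'(2) sK] unfolding max_subgraph_def
        by (metis induced_imp_subgraph)
      then have "subgraph H' H"
        using sK by simp
      then have "H = H'"
        using H'(2) unfolding subgraph_def compatible_def
        by (intro pre_digraph.equality equalityI) (blast | simp)+
      then show False
        using H'(1) by simp
    qed
  qed
  ultimately show ?thesis
    unfolding components_def sccs_altdef2 by blast
qed

lemma (in fin_digraph) finite_sccs: "finite sccs"
  using finite_sccs_verts by (simp add: sccs_conv_sccs_verts)

lemma (in sym_digraph) dominates_sccs:
  assumes "H \<in> sccs" "u \<in> verts H" "u \<rightarrow> v"
  shows "v \<in> verts H"
proof -
  have "verts H \<in> sccs_verts"
    using assms(1) by (simp add: sccs_verts_conv)
  moreover have "u \<rightarrow>\<^sup>* v" "v \<rightarrow>\<^sup>* u"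
    using assms(3) symmetric_reachable' by auto
  ultimately show ?thesis
    using assms(2) unfolding in_sccs_verts_conv_reachable by blast
qed

lemma (in sym_digraph) dominates_sym: "u \<rightarrow> v \<Longrightarrow> v \<rightarrow> u"
  using sym_arcs by (rule arcs_ends_symmetric)

text \<open>No edge leaves a component. The equations at vertices outside \<open>H\<close> are
  therefore trivial for a vector supported on \<open>H\<close>.\<close>

lemma (in pseudo_graph) null_space_sccs_iff:
  assumes "H \<in> sccs"
  shows "x \<in> null_space H \<longleftrightarrow> x \<in> null_space G \<and> (\<forall>v. v \<notin> verts H \<longrightarrow> x v = 0)"
proof -
  have H: "induced_subgraph H G"
    using assms by (rule in_sccs_imp_induced)
  then have sub: "verts H \<subseteq> verts G" and eq: "G \<restriction> verts H = H"
    by (auto simp: induce_eq_iff_induced)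
  have "adjacency G u v * x v = 0" if "u \<notin> verts H" "\<forall>v. v \<notin> verts H \<longrightarrow> x v = 0" for u v
    using that dominates_sccs[OF assms, of v u] dominates_sym[of u v]
    by (cases "v \<in> verts H") (auto simp: adjacency_def)
  then have "(\<Sum>v\<in>verts G. adjacency G u v * x v) = 0"
    if "u \<notin> verts H" "\<forall>v. v \<notin> verts H \<longrightarrow> x v = 0" for u
    using that by (intro sum.neutral) blast
  then show ?thesis
    using null_space_induce_iff[OF finite_verts sub, of x] sub unfolding eq null_space_iff[of x G]
    by blast
qed

text \<open>A null vector is the sum of its restrictions to the components, each of which is a null
  vector since neighbours stay in the component. Directness comes from disjoint vertex sets.\<close>

lemma (in pseudo_graph) null_space_components:
  "is_direct_sum (null_space G) (components G) null_space"
  unfolding is_direct_sum_def components_eq_sccs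
proof (intro conjI ballI allI impI)
  show "finite sccs"
    by (rule finite_sccs)
  show "subspace (null_space H)" for H :: "('a, 'b) pre_digraph"
    by (rule subspace_null_space)
  have outside: "w H v = 0"
    if "\<forall>H\<in>sccs. w H \<in> null_space H" "H \<in> sccs" "K \<in> sccs" "H \<noteq> K" "v \<in> verts K"
    for w :: "('a, 'b) pre_digraph \<Rightarrow> 'a \<Rightarrow> real" and H K v
    using that scc_disj[of H K] by (auto simp: null_space_iff)
  \<comment> \<open>At a vertex of \<open>K\<close> only the summand of \<open>K\<close> can be
    nonzero; this gives both the decomposition and its uniqueness.\<close>
  have sum_eq: "(\<Sum>H\<in>sccs. w H) v = w K v"
    if "\<forall>H\<in>sccs. w H \<in> null_space H" "K \<in> sccs" "v \<in> verts K"
    for w :: "('a, 'b) pre_digraph \<Rightarrow> 'a \<Rightarrow> real" and K v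
  proof -
    have "(\<Sum>H\<in>sccs. w H) v = (\<Sum>H\<in>sccs. if H = K then w K v else 0)"
      unfolding sum_fun_apply using outside[OF that(1) _ that(2) _ that(3)] by (intro sum.cong) auto
    then show ?thesis
      using that(2) finite_sccs by simp
  qed
  show "null_space G = {\<Sum>H\<in>sccs. w H |w. \<forall>H\<in>sccs. w H \<in> null_space H}"
  proof (intro equalityI subsetI)
    fix x assume x: "x \<in> null_space G"
    define w where "w H = (\<lambda>v. if v \<in> verts H then x v else 0)" for H :: "('a, 'b) pre_digraph"
    have w: "\<forall>H\<in>sccs. w H \<in> null_space H"
    proof
      fix H assume H: "H \<in> sccs"
      have iH: "induced_subgraph H G"
        using H by (rule in_sccs_imp_induced)
      then have sub: "verts H \<subseteq> verts G" and eq: "G \<restriction> verts H = H"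
        by (auto simp: induce_eq_iff_induced)
      have "(\<Sum>v\<in>verts G. adjacency G u v * w H v) = (\<Sum>v\<in>verts G. adjacency G u v * x v)"
        if "u \<in> verts H" for u
        using dominates_sccs[OF H that] by (intro sum.cong) (auto simp: w_def adjacency_def)
      then show "w H \<in> null_space H"
        using null_space_induce_iff[OF finite_verts sub, of "w H"] x sub
        by (auto simp: eq null_space_iff[of x] w_def)
    qed
    have "x = (\<Sum>H\<in>sccs. w H)"
    proof
      fix v
      show "x v = (\<Sum>H\<in>sccs. w H) v"
      proof (cases "v \<in> verts G")
        case True
        then obtain K where "K \<in> sccs" "v \<in> verts K"
          using scc_of_in_sccs_verts in_scc_of_self unfolding sccs_verts_conv by blast
        then show ?thesis
          using sum_eq[OF w] by (simp add: w_def)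
      next
        case False
        then show ?thesis
          using x by (simp add: sum_fun_apply w_def null_space_iff cong: if_cong)
      qed
    qed
    then show "x \<in> {\<Sum>H\<in>sccs. w H |w. \<forall>H\<in>sccs. w H \<in> null_space H}"
      using w by blast
  next
    fix x assume "x \<in> {\<Sum>H\<in>sccs. w H |w. \<forall>H\<in>sccs. w H \<in> null_space H}"
    then show "x \<in> null_space G"
      using null_space_sccs_iff by (auto intro!: subspace_sum subspace_null_space)
  qed
  fix w :: "('a, 'b) pre_digraph \<Rightarrow> 'a \<Rightarrow> real" and K
  assume w: "(\<forall>H\<in>sccs. w H \<in> null_space H) \<and> (\<Sum>H\<in>sccs. w H) = 0" and K: "K \<in> sccs"
  show "w K = 0"
  proof
    fix v
    show "w K v = 0 v"
      using w K sum_eq[of w K v] by (cases "v \<in> verts K") (auto simp: null_space_iff)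
  qed
qed

subsection \<open>Alternating cycles\<close>

text \<open>Some value repeats. Taking the least gap \<open>d\<close> over all repetitions, at any
  position, excludes a shorter repetition inside the window.\<close>

lemma closed_sequence_if_finite:
  fixes s :: "nat \<Rightarrow> 'a"
  assumes "finite (range s)"
  obtains i d where "0 < d" "s (i + d) = s i" "inj_on (\<lambda>k. s (i + k)) {..<d}"
proof -
  define P where "P d \<longleftrightarrow> 0 < d \<and> (\<exists>i. s (i + d) = s i)" for d
  have "\<not> inj s"
    using assms finite_imageD by blast
  then obtain i j where ij: "s i = s j" "i < j"
    by (metis injI linorder_neqE_nat)
  then have "P (j - i)"
    unfolding P_def by (metis le_add_diff_inverse less_imp_le zero_less_diff)
  then have d: "P (LEAST d. P d)"
    by (rule LeastI)
  define d where "d = (LEAST d. P d)"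
  obtain i where i: "s (i + d) = s i" and "0 < d"
    using d unfolding P_def d_def by blast
  have "s (i + a) \<noteq> s (i + b)" if "a < b" "b < d" for a b
  proof
    assume "s (i + a) = s (i + b)"
    then have "P (b - a)"
      unfolding P_def using that by (intro conjI exI[of _ "i + a"]) auto
    then have "d \<le> b - a"
      unfolding d_def by (rule Least_le)
    then show False
      using that by simp
  qed
  then have "inj_on (\<lambda>k. s (i + k)) {..<d}"
    by (intro linorder_inj_onI) auto
  then show ?thesis
    using that \<open>0 < d\<close> i by blast
qed

lemma (in wf_digraph) cycle_of_closed_sequence:
  assumes n: "0 < n" and step: "\<And>k. s k \<rightarrow> s (Suc k)" and closed: "s n = s 0"
    and inj: "inj_on s {..<n}"
  obtains p where "cycle p" "length p = n"
proof -
  have "\<exists>e. e \<in> arcs G \<and> tail G e = s k \<and> head G e = s (Suc k)" for k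
    using step[of k] by (auto simp: arcs_ends_conv)
  then obtain e where e: "\<And>k. e k \<in> arcs G" "\<And>k. tail G (e k) = s k"
    "\<And>k. head G (e k) = s (Suc k)"
    by metis
  define p where "p = map e [0..<n]"
  have "cas (s 0) (map e [0..<m]) (s m)" for m
    by (induction m) (simp_all add: e awlast_if_cas)
  then have cas: "cas (s 0) p (s 0)"
    unfolding p_def by (metis closed)
  have "tl (awalk_verts (s 0) p) = map (\<lambda>k. s (Suc k)) [0..<n]"
    unfolding awalk_verts_conv'[OF cas] using n by (simp add: p_def e)
  \<comment> \<open>\<open>cycle\<close> wants distinct vertices after dropping the first one, so
    the indices are shifted by one and the last value \<open>s n\<close> has to be read as
    \<open>s 0\<close>.\<close>
  moreover have "inj_on (\<lambda>k. s (Suc k)) {0..<n}"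
  proof (rule linorder_inj_onI)
    fix a b assume ab: "a < b" "a \<in> {0..<n}" "b \<in> {0..<n}"
    show "s (Suc a) \<noteq> s (Suc b)"
    proof (cases "Suc b = n")
      case True
      then show ?thesis
        using ab n inj_onD[OF inj, of "Suc a" 0] closed by auto
    next
      case False
      then show ?thesis
        using ab n inj_onD[OF inj, of "Suc a" "Suc b"] by auto
    qed
  qed auto
  ultimately have "distinct (tl (awalk_verts (s 0) p))"
    by (simp add: distinct_map)
  moreover have "awalk (s 0) p (s 0)"
    using cas e(1) tail_in_verts[OF e(1)[of 0]] by (auto simp: awalk_def p_def e(2))
  ultimately have "cycle p"
    using n by (auto simp: cycle_def p_def)
  then show ?thesis
    using that by (simp add: p_def)
qed

text \<open>Otherwise all products \<open>f a * f b\<close> are nonnegative with sum 0, forcing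
  \<open>f a * f a = 0\<close>.\<close>

lemma sum_zero_opposite_sign:
  fixes f :: "'a \<Rightarrow> real"
  assumes "finite A" "sum f A = 0" "a \<in> A" "f a \<noteq> 0"
  obtains b where "b \<in> A" "f a * f b < 0"
proof -
  have "\<exists>b\<in>A. f a * f b < 0"
  proof (rule ccontr)
    assume "\<not> ?thesis"
    moreover have "(\<Sum>b\<in>A. f a * f b) = 0"
      using assms(2) by (simp flip: sum_distrib_left)
    ultimately have "f a * f a = 0"
      using assms(1,3) by (subst (asm) sum_nonneg_eq_0_iff) (auto simp: not_less)
    then show False
      using assms(4) by simp
  qed
  then show ?thesis
    using that by blast
qed

lemma mult_chain_less_0_iff:
  fixes a b c :: real
  shows "(a * b) * (b * c) < 0 \<longleftrightarrow> b \<noteq> 0 \<and> a * c < 0"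
proof -
  have "(a * b) * (b * c) = b\<^sup>2 * (a * c)"
    by (simp add: power2_eq_square)
  then show ?thesis
    by (simp only: mult_less_0_iff[of "b\<^sup>2"]) simp
qed

text \<open>An edge \<open>a b\<close> carries the weight \<open>g a * g b\<close>. The factor
  \<open>g v\<close> in the third assumption says that the weights at \<open>v\<close> sum to zero,
  and demands nothing of the neighbours where \<open>g v = 0\<close>.\<close>

lemma (in graph) bipartite_C4k_free_product_zero:
  fixes g :: "'a \<Rightarrow> real"
  assumes C4k: "\<And>p. cycle p \<Longrightarrow> \<not> 4 dvd length p"
    and cross: "\<And>u v. u \<rightarrow> v \<Longrightarrow> u \<in> A \<longleftrightarrow> v \<notin> A"
    and g: "\<And>v. v \<in> verts G \<Longrightarrow> g v * (\<Sum>w\<in>verts G. adjacency G v w * g w) = 0"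
    and uv: "u \<rightarrow> v"
  shows "g u * g v = 0"
proof (rule ccontr)
  assume nz: "g u * g v \<noteq> 0"
  define R where "R a b \<longleftrightarrow> a \<rightarrow> b \<and> (if a \<in> A then g a * g b > 0 else g a * g b < 0)" for a b
  \<comment> \<open>The weights at \<open>b\<close> sum to zero, so some edge at \<open>b\<close>
    has the sign opposite to that of \<open>a b\<close>. As \<open>b\<close> is in the other class,
    this is the sign required for leaving \<open>b\<close>.\<close>
  have R_next: "\<exists>c. R b c" if "R a b" for a b
  proof -
    have ab: "a \<rightarrow> b" "g a * g b \<noteq> 0" and ba: "b \<rightarrow> a"
      using that dominates_sym by (auto simp: R_def split: if_splits)
    let ?f = "\<lambda>w. adjacency G b w * g w"
    have "b \<in> verts G" "a \<in> verts G"
      using ab(1) by (auto dest: adj_in_verts)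
    then have "sum ?f (verts G) = 0" and "?f a \<noteq> 0"
      using g[of b] ab(2) ba by (auto simp: adjacency_def)
    then obtain c where "?f a * ?f c < 0"
      using sum_zero_opposite_sign[of "verts G" ?f a] \<open>a \<in> verts G\<close> by auto
    then have c: "b \<rightarrow> c" and neg: "g a * g c < 0"
      using ba by (auto simp: adjacency_def split: if_splits)
    have "(g a * g b) * (g b * g c) < 0"
      using neg ab(2) by (simp add: mult_chain_less_0_iff)
    then have "R b c"
      using that cross[OF ab(1)] c
      by (auto simp: R_def mult_less_0_iff[of "g a * g b"] split: if_splits)
    then show ?thesis ..
  qed
  \<comment> \<open>The edge \<open>u v\<close> has nonzero weight, so exactly one of its two
    directions fits \<open>R\<close>: from the end in \<open>A\<close> if the weight is positive,
    towards it otherwise.\<close>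
  obtain a b where ab: "R a b"
    using nz uv dominates_sym[OF uv] cross[OF uv] unfolding R_def
    by (metis linorder_neqE_linordered_idom mult.commute)
  have "\<exists>s. \<forall>k. (\<exists>b. R (s k) b) \<and> R (s k) (s (Suc k))"
    by (rule dependent_nat_choice) (use ab R_next in blast)+
  then obtain s where s: "\<And>k. R (s k) (s (Suc k))"
    by blast
  then have adj: "\<And>k. s k \<rightarrow> s (Suc k)"
    by (simp add: R_def)
  then have "range s \<subseteq> verts G"
    by (auto dest: adj_in_verts)
  then have "finite (range s)"
    using finite_subset finite_verts by blast
  then obtain i d where d: "0 < d" "s (i + d) = s i" "inj_on (\<lambda>k. s (i + k)) {..<d}"
    by (rule closed_sequence_if_finite)
  define t where "t k = s (i + k)" for k
  have t: "R (t k) (t (Suc k))" "t k \<rightarrow> t (Suc k)" for k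
    using s adj by (auto simp: t_def)
  have closed: "t d = t 0"
    using d by (simp add: t_def)
  have "inj_on t {..<d}"
    using d(3) by (simp add: t_def[abs_def])
  then obtain p where p: "cycle p" "length p = d"
    using cycle_of_closed_sequence[of d t] d(1) t(2) closed by blast
  have parity: "t k \<in> A \<longleftrightarrow> (even k \<longleftrightarrow> t 0 \<in> A)" for k
  proof (induction k)
    case (Suc k)
    then show ?case
      using cross[OF t(2)[of k]] by auto
  qed simp
  have "even d"
    using parity[of d] closed by auto
  then obtain m where m: "d = 2 * m"
    by blast
  \<comment> \<open>Consecutive edges have weights of opposite sign; the shared vertex contributes
    only a square to their product.\<close>
  have flip: "g (t k) * g (t (Suc (Suc k))) < 0" for k
  proof -
    have "(g (t k) * g (t (Suc k))) * (g (t (Suc k)) * g (t (Suc (Suc k)))) < 0"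
      using t(1)[of k] t(1)[of "Suc k"] cross[OF t(2)[of k]]
      by (auto simp: R_def intro: mult_pos_neg mult_neg_pos split: if_splits)
    then show ?thesis
      by (simp add: mult_chain_less_0_iff)
  qed
  have "(- 1) ^ j * (g (t 0) * g (t (2 * j))) > 0" for j
  proof (induction j)
    case 0
    have "g (t 0) \<noteq> 0"
      using flip[of 0] by auto
    then show ?case
      by (auto simp: zero_less_mult_iff linorder_neq_iff)
  next
    case (Suc j)
    have "((- 1) ^ j * g (t 0) * g (t (2 * j))) * (g (t (2 * j)) * g (t (Suc (Suc (2 * j))))) < 0"
      using Suc by (intro mult_pos_neg flip) (simp only: mult.assoc)
    then have "(- 1) ^ j * g (t 0) * g (t (Suc (Suc (2 * j)))) < 0"
      by (simp only: mult_chain_less_0_iff)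
    then show ?case
      by (simp add: mult.assoc)
  qed
  \<comment> \<open>After \<open>m\<close> double steps the walk is back at \<open>t 0\<close>,
    where the product is a square; so the sign \<open>(- 1) ^ m\<close> must be positive.\<close>
  from this[of m] have "even m"
    using closed m by (cases "even m") (auto simp: mult_less_0_iff)
  then have "4 dvd length p"
    using p m by (auto elim!: evenE)
  then show False
    using C4k p by blast
qed

subsection \<open>Support and core\<close>

lemma Supp_Core_subset: "Supp G \<union> Core G \<subseteq> verts G"
  by (auto simp: Supp_def Core_def)

lemma null_space_C_S_iff:
  assumes "finite (verts G)"
  shows "x \<in> null_space (C_S G) \<longleftrightarrow> (\<forall>v. v \<notin> Supp G \<union> Core G \<longrightarrow> x v = 0) \<and>
    (\<forall>u\<in>Supp G \<union> Core G. (\<Sum>v\<in>verts G. adjacency G u v * x v) = 0)"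
  unfolding C_S_def using assms Supp_Core_subset by (rule null_space_induce_iff)

text \<open>Both vectors merge into one \<open>g\<close>: \<open>y\<close> on the colour class of
  \<open>u\<close>, \<open>x\<close> on the other. The equation at a vertex then involves only the
  vector of the opposite class.\<close>

lemma null_space_edge_product_zero:
  assumes G: "C4k_free_bipartite G" and x: "x \<in> null_space G" and y: "y \<in> null_space (C_S G)"
    and uv: "u \<rightarrow>\<^bsub>G\<^esub> v"
  shows "y u * x v = 0"
proof -
  interpret graph G
    using G by (simp add: C4k_free_bipartite_def)
  have "bipartite G"
    using G by (simp add: C4k_free_bipartite_def)
  then obtain A B where AB: "A \<inter> B = {}"
    "\<forall>e\<in>arcs G. (tail G e \<in> A \<and> head G e \<in> B) \<or> (tail G e \<in> B \<and> head G e \<in> A)"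
    unfolding bipartite_def by auto
  have cross: "a \<in> A \<longleftrightarrow> b \<notin> A" if "a \<rightarrow>\<^bsub>G\<^esub> b" for a b
    using that AB by (auto simp: arcs_ends_conv)
  define g where "g w = (if w \<in> A \<longleftrightarrow> u \<in> A then y w else x w)" for w
  have "g a * (\<Sum>b\<in>verts G. adjacency G a b * g b) = 0" if a: "a \<in> verts G" for a
  proof (cases "a \<in> A \<longleftrightarrow> u \<in> A")
    case True
    then have "(\<Sum>b\<in>verts G. adjacency G a b * g b) = (\<Sum>b\<in>verts G. adjacency G a b * x b)"
      using cross by (intro sum.cong) (auto simp: adjacency_def g_def)
    then show ?thesis
      using x a by (simp add: null_space_iff)
  next
    case False
    then have "(\<Sum>b\<in>verts G. adjacency G a b * g b) = (\<Sum>b\<in>verts G. adjacency G a b * y b)"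
      using cross by (intro sum.cong) (auto simp: adjacency_def g_def)
    \<comment> \<open>The equations of \<open>y\<close> are known only at vertices of
      \<open>C_S G\<close>. Elsewhere the factor \<open>g a = x a\<close> is zero.\<close>
    moreover have "a \<in> Supp G" if "x a \<noteq> 0"
      using that x a by (auto simp: Supp_def)
    ultimately show ?thesis
      using False y by (auto simp: null_space_C_S_iff g_def)
  qed
  then have "g u * g v = 0"
    using G cross uv unfolding C4k_free_bipartite_def
    by (intro bipartite_C4k_free_product_zero[of A]) auto
  then show ?thesis
    using cross[OF uv] by (auto simp: g_def)
qed

lemma null_space_C_S:
  assumes G: "C4k_free_bipartite G"
  shows "null_space (C_S G) = null_space G"
proof (intro equalityI subsetI)
  interpret graph G
    using G by (simp add: C4k_free_bipartite_def)
  fix y assume y: "y \<in> null_space (C_S G)"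
  \<comment> \<open>A core vertex has a neighbour where some null vector \<open>x\<close> of
    \<open>G\<close> is nonzero, so the edge product forces \<open>y\<close> to vanish.\<close>
  have Core: "y u = 0" if u: "u \<in> Core G" for u
  proof -
    obtain v x where "v \<rightarrow>\<^bsub>G\<^esub> u" "x \<in> null_space G" "x v \<noteq> 0"
      using u by (auto simp: Core_def Supp_def)
    then show ?thesis
      using null_space_edge_product_zero[OF G _ y, of x u v] dominates_sym by auto
  qed
  have "(\<Sum>v\<in>verts G. adjacency G u v * y v) = 0" if u: "u \<in> verts G" for u
  proof (cases "u \<in> Supp G \<union> Core G")
    case True
    then show ?thesis
      using y by (simp add: null_space_C_S_iff)
  next
    case False
    \<comment> \<open>A neighbour in the support would put \<open>u\<close> into the core. So every
      neighbour lies in the core or outside \<open>C_S G\<close>, and \<open>y\<close> vanishes at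
      both.\<close>
    have "y v = 0" if "u \<rightarrow>\<^bsub>G\<^esub> v" for v
    proof (cases "v \<in> Supp G")
      case True
      then have "u \<in> Core G"
        using u dominates_sym[OF that] by (auto simp: Core_def)
      then show ?thesis
        using False by simp
    next
      case notin: False
      show ?thesis
        using notin Core[of v] y by (auto simp: null_space_C_S_iff)
    qed
    then show ?thesis
      by (intro sum.neutral) (auto simp: adjacency_def)
  qed
  then show "y \<in> null_space G"
    using y Supp_Core_subset[of G] by (auto simp: null_space_iff[of y G] null_space_C_S_iff)
next
  interpret graph G
    using G by (simp add: C4k_free_bipartite_def)
  fix x assume x: "x \<in> null_space G"
  then have "x v = 0" if "v \<notin> verts G" for v
    using that by (simp add: null_space_iff)
  then have "x v = 0" if "v \<notin> Supp G" for v
    using x that unfolding Supp_def by blast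
  then show "x \<in> null_space (C_S G)"
    using x Supp_Core_subset[of G] by (auto simp: null_space_iff[of x G] null_space_C_S_iff)
qed

theorem theorem5p1:
  fixes G :: "('a, 'b) pre_digraph"
  assumes "C4k_free_bipartite G"
  shows "(nullity G = nullity (C_S G) \<and>
          nullity (C_S G) = (\<Sum>H\<in>components (C_S G). nullity H)) \<and>
         null_space G = lift_vec (C_S G) G ` null_space (C_S G) \<and>
         is_direct_sum (null_space (C_S G)) (components (C_S G))
           (\<lambda>H. lift_vec H (C_S G) ` null_space H) \<and>
         is_direct_sum (null_space G) (components (C_S G))
           (\<lambda>H. lift_vec H G ` null_space H)"
proof -
  interpret graph G
    using assms by (simp add: C4k_free_bipartite_def)
  have ind: "induced_subgraph (C_S G) G"
    unfolding C_S_def using Supp_Core_subset by (rule induced_induce)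
  then have sub: "verts (C_S G) \<subseteq> verts G"
    by auto
  interpret CS: pseudo_graph "C_S G"
    using digraphI_induced[OF ind] induced_graph_imp_graph[OF ind]
    by (simp add: pseudo_graph_def digraph_def)
  note eq = null_space_C_S[OF assms]
  have ds: "is_direct_sum (null_space (C_S G)) (components (C_S G)) null_space"
    by (rule CS.null_space_components)
  have sub_comp: "verts H \<subseteq> verts (C_S G)" if "H \<in> components (C_S G)" for H
    using that CS.subgraphI_max_subgraph unfolding components_def by blast
  \<comment> \<open>Both direct sums of the theorem are instances, with \<open>F\<close> being
    \<open>C_S G\<close> or \<open>G\<close>.\<close>
  have lift: "is_direct_sum (null_space (C_S G)) (components (C_S G))
      (\<lambda>H. lift_vec H F ` null_space H)" if "verts (C_S G) \<subseteq> verts F" for F :: "('a, 'b) pre_digraph"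
  proof -
    have "lift_vec H F ` null_space H = null_space H" if "H \<in> components (C_S G)" for H
      using sub_comp[OF that] \<open>verts (C_S G) \<subseteq> verts F\<close> by (intro lift_vec_null_space) (rule subset_trans)
    then show ?thesis
      using ds is_direct_sum_cong[of "components (C_S G)" "\<lambda>H. lift_vec H F ` null_space H" null_space]
      by simp
  qed
  obtain T where "finite T" "null_space (C_S G) \<subseteq> span T"
    by (rule null_space_finite_dimensional[OF CS.finite_verts])
  then have "nullity (C_S G) = (\<Sum>H\<in>components (C_S G). nullity H)"
    unfolding nullity_def by (rule dim_is_direct_sum[OF ds])
  moreover have "null_space G = lift_vec (C_S G) G ` null_space (C_S G)"
    using lift_vec_null_space[OF sub] eq by simp
  moreover have "nullity G = nullity (C_S G)"
    by (simp add: nullity_def eq)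
  ultimately show ?thesis
    using lift[of "C_S G"] lift[OF sub] eq by simp
qed

end
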